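(* If $G$ is a connected simple chordal graph on $n\ge 2$ vertices with $p$ blocks, then $\mathrm{hn}_{cc}(G)=p+1$.
   Context: A chordal graph is a graph with no induced cycle of length greater than $3$. A block of a graph is a maximal connected subgraph without a cut-vertex. A cycle is a closed walk $(v_1,\dots,v_q,v_1)$ with at least one edge in which the only repeated vertex is $v_1$. For $S\subseteq V(G)$ let $I_{cc}(S)=S\cup\{v\in V(G): \text{there is a cycle } C \text{ of } G \text{ with } V(C)\setminus S=\{v\}\}$. A set $S$ is convex if $I_{cc}(S)=S$; $\mathrm{hull}(S)$ is the smallest convex set containing $S$; $S$ is a hull set if $\mathrm{hull}(S)=V(G)$; $\mathrm{hn}_{cc}(G)$ is the minimum cardinality of a hull set of $G$.
   Formalization: Cycles are required to have at least three edges; the definition as worded also admits the closed walk back and forth along one edge, under which every connected graph would have hull number 1 and the claim would fail (e.g. for a single edge). *)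

theory Defs
  imports "Graph_Theory.Digraph_Component"
begin

text \<open>
  A finite simple graph is a \<^locale>\<open>pair_graph\<close>: each edge is represented by its two
  opposite arcs.
\<close>

text \<open>
  \<^const>\<open>pre_digraph.cycle\<close> also admits the closed walk that goes back and forth along a
  single edge; cycles of a simple graph have at least three edges.
\<close>

definition graph_cycle :: "'a pair_pre_digraph \<Rightarrow> ('a \<times> 'a) awalk \<Rightarrow> bool" where
  "graph_cycle G c \<longleftrightarrow> pre_digraph.cycle (with_proj G) c \<and> length c \<ge> 3"

text \<open>A cycle is closed, so each of its vertices is the first component of one of its arcs.\<close>

definition cycle_verts :: "('a \<times> 'a) awalk \<Rightarrow> 'a set" where
  "cycle_verts c = fst ` set c"

definition cycle_graph :: "('a \<times> 'a) awalk \<Rightarrow> 'a pair_pre_digraph" where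
  "cycle_graph c = \<lparr> pverts = cycle_verts c, parcs = set c \<union> (set c)\<inverse> \<rparr>"

definition chordal :: "'a pair_pre_digraph \<Rightarrow> bool" where
  "chordal G \<longleftrightarrow>
    \<not> (\<exists>c. graph_cycle G c \<and> length c > 3
          \<and> induced_subgraph (with_proj (cycle_graph c)) (with_proj G))"

text \<open>
  In a symmetric digraph the strongly connected components are the connected components of the
  graph. They are nonempty by definition, so the vertex of a one-vertex graph is not a cut-vertex.
\<close>

definition cut_vertex :: "('a, 'b) pre_digraph \<Rightarrow> 'a \<Rightarrow> bool" where
  "cut_vertex H v \<longleftrightarrow> v \<in> verts H
    \<and> card (pre_digraph.sccs H) < card (pre_digraph.sccs (pre_digraph.del_vert H v))"

text \<open>
  A subdigraph of a symmetric digraph need not be symmetric; the symmetric ones are the subgraphs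
  of the undirected graph.
\<close>

definition blocks :: "'a pair_pre_digraph \<Rightarrow> ('a, 'a \<times> 'a) pre_digraph set" where
  "blocks G = {B. pre_digraph.max_subgraph (with_proj G)
     (\<lambda>H. symmetric H \<and> connected H \<and> \<not> (\<exists>v. cut_vertex H v)) B}"

definition I_cc :: "'a pair_pre_digraph \<Rightarrow> 'a set \<Rightarrow> 'a set" where
  "I_cc G S = S \<union> {v \<in> pverts G. \<exists>c. graph_cycle G c \<and> cycle_verts c - S = {v}}"

definition cc_convex :: "'a pair_pre_digraph \<Rightarrow> 'a set \<Rightarrow> bool" where
  "cc_convex G S \<longleftrightarrow> S \<subseteq> pverts G \<and> I_cc G S = S"

definition cc_hull :: "'a pair_pre_digraph \<Rightarrow> 'a set \<Rightarrow> 'a set" where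
  "cc_hull G S = cc_convex G hull S"

text \<open>
  \<^const>\<open>hull\<close> is an intersection of convex sets; the following lemmas show that it is
  the smallest convex set containing \<open>S\<close>.
\<close>

lemma cc_convex_pverts: "cc_convex G (pverts G)"
  by (auto simp: cc_convex_def I_cc_def)

lemma cc_convex_Inter:
  assumes "F \<noteq> {}" and F: "\<And>C. C \<in> F \<Longrightarrow> cc_convex G C"
  shows "cc_convex G (\<Inter>F)"
proof -
  have "v \<in> C" if "v \<in> pverts G" "graph_cycle G c" "cycle_verts c - \<Inter>F = {v}" "C \<in> F" for v c C
  proof (rule ccontr)
    assume "v \<notin> C"
    with that have "cycle_verts c - C = {v}" by blast
    with that have "v \<in> I_cc G C" by (auto simp: I_cc_def)
    with F[OF \<open>C \<in> F\<close>] \<open>v \<notin> C\<close> show False by (simp add: cc_convex_def)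
  qed
  then have "I_cc G (\<Inter>F) = \<Inter>F" by (auto simp: I_cc_def)
  moreover have "\<Inter>F \<subseteq> pverts G" using assms by (auto simp: cc_convex_def)
  ultimately show ?thesis by (simp add: cc_convex_def)
qed

lemma cc_convex_cc_hull: "S \<subseteq> pverts G \<Longrightarrow> cc_convex G (cc_hull G S)"
  unfolding cc_hull_def hull_def using cc_convex_pverts by (intro cc_convex_Inter) auto

lemma cc_hull_superset: "S \<subseteq> cc_hull G S"
  by (simp add: cc_hull_def hull_subset)

lemma cc_hull_least: "cc_convex G C \<Longrightarrow> S \<subseteq> C \<Longrightarrow> cc_hull G S \<subseteq> C"
  by (simp add: cc_hull_def hull_minimal)

definition hull_set :: "'a pair_pre_digraph \<Rightarrow> 'a set \<Rightarrow> bool" where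
  "hull_set G S \<longleftrightarrow> S \<subseteq> pverts G \<and> cc_hull G S = pverts G"

definition hn_cc :: "'a pair_pre_digraph \<Rightarrow> nat" where
  "hn_cc G = (LEAST k. \<exists>S. hull_set G S \<and> card S = k)"

end

theory Submission
  imports Defs Complex_Main
begin

text \<open>
  Upper bound: in a chordal graph a convex set that contains an edge contains the whole block of that
  edge, because a shortest cycle through an edge of the set and a vertex outside it has no chord and
  is therefore a triangle. Adding one vertex per block to an initial vertex thus gives a hull set with
  \<open>p + 1\<close> elements.

  Lower bound (valid in every connected graph): each block \<open>B\<close> has a labelling
  \<open>t\<^sub>B\<close> of the vertices that is injective on \<open>B\<close> and constant on every other
  block. If \<open>S\<close> has at most \<open>p\<close> elements, one of which is \<open>s\<^sub>0\<close>,
  some nontrivial combination of the \<open>p\<close> functions \<open>t\<^sub>B - t\<^sub>B(s\<^sub>0)\<close> vanishes on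
  \<open>S\<close>. On a block such a function is affine in \<open>t\<^sub>B\<close>, and a cycle lies in one
  block, so its zero set is convex. It is not everything, since the combination is nonconstant on a
  block with nonzero coefficient.
\<close>

subsection \<open>Connected and biconnected vertex sets\<close>

definition connected_on :: "'a rel \<Rightarrow> 'a set \<Rightarrow> bool" where
  "connected_on r W \<longleftrightarrow> (\<forall>u\<in>W. \<forall>v\<in>W. (u, v) \<in> (Restr r W)\<^sup>*)"

text \<open>Single vertices and single edges qualify, because \<open>connected_on\<close> holds for
  the empty set. This matches blocks, where the vertex of a one-vertex graph is not a
  cut-vertex.\<close>

definition biconnected_on :: "'a rel \<Rightarrow> 'a set \<Rightarrow> bool" where
  "biconnected_on r W \<longleftrightarrow>
    W \<noteq> {} \<and> connected_on r W \<and> (\<forall>v\<in>W. connected_on r (W - {v}))"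

abbreviation path_in :: "'a rel \<Rightarrow> 'a list \<Rightarrow> bool" where
  "path_in r xs \<equiv> distinct xs \<and> successively (\<lambda>x y. (x, y) \<in> r) xs"

lemma connected_on_singleton: "connected_on r {v}"
  by (simp add: connected_on_def)

lemma connected_on_pair: "sym r \<Longrightarrow> (u, v) \<in> r \<Longrightarrow> connected_on r {u, v}"
  by (auto simp: connected_on_def intro!: r_into_rtrancl dest: symD)

lemma connected_on_Un:
  assumes "connected_on r A" "connected_on r B" "A \<inter> B \<noteq> {}"
  shows "connected_on r (A \<union> B)"
proof -
  obtain z where z: "z \<in> A" "z \<in> B" using assms by auto
  have mono: "(Restr r A)\<^sup>* \<subseteq> (Restr r (A \<union> B))\<^sup>*" "(Restr r B)\<^sup>* \<subseteq> (Restr r (A \<union> B))\<^sup>*"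
    by (intro rtrancl_mono; blast)+
  have "(u, z) \<in> (Restr r (A \<union> B))\<^sup>* \<and> (z, u) \<in> (Restr r (A \<union> B))\<^sup>*" if "u \<in> A \<union> B" for u
    using that z assms(1,2) mono unfolding connected_on_def by blast
  then show ?thesis unfolding connected_on_def by (meson rtrancl_trans)
qed

lemma connected_on_path:
  assumes "sym r" "successively (\<lambda>x y. (x, y) \<in> r) xs"
  shows "connected_on r (set xs)"
  using assms(2)
proof (induction xs)
  case (Cons x xs)
  show ?case
  proof (cases xs)
    case (Cons y ys)
    then have "connected_on r ({x, y} \<union> set xs)"
      using Cons.IH Cons.prems by (intro connected_on_Un connected_on_pair \<open>sym r\<close>) auto
    then show ?thesis using Cons by (simp add: insert_absorb)
  qed (simp add: connected_on_singleton)
qed (simp add: connected_on_def)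

lemma biconnected_on_edge:
  assumes "sym r" "(u, v) \<in> r"
  shows "biconnected_on r {u, v}"
  using connected_on_pair[OF assms] connected_on_singleton[of r]
  by (auto simp: biconnected_on_def insert_Diff_if connected_on_def)

lemma connected_on_biconnected_Diff:
  "biconnected_on r W \<Longrightarrow> connected_on r (W - {v})"
  by (cases "v \<in> W") (auto simp: biconnected_on_def)

text \<open>Whichever vertex is deleted, one of the two common vertices survives and links the two
  connected remainders.\<close>

lemma biconnected_on_Un:
  assumes "biconnected_on r A" "biconnected_on r B" "u \<in> A \<inter> B" "v \<in> A \<inter> B" "u \<noteq> v"
  shows "biconnected_on r (A \<union> B)"
proof -
  have "connected_on r ((A \<union> B) - {w})" for w
    using assms unfolding Un_Diff
    by (intro connected_on_Un connected_on_biconnected_Diff) auto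
  moreover have "connected_on r (A \<union> B)"
    using assms by (intro connected_on_Un) (auto simp: biconnected_on_def)
  ultimately show ?thesis using assms by (auto simp: biconnected_on_def)
qed

text \<open>Deleting a vertex of the path leaves two pieces, and each nonempty piece still contains
  an end of the path, which lies in \<open>B\<close>. Deleting any other vertex leaves the path
  whole and attached at its head. Inner vertices of the path may lie in \<open>B\<close> as
  well.\<close>

lemma biconnected_on_ear:
  assumes r: "sym r" and B: "biconnected_on r B" and xs: "path_in r xs" "xs \<noteq> []"
    and ends: "hd xs \<in> B" "last xs \<in> B" "hd xs \<noteq> last xs"
  shows "biconnected_on r (B \<union> set xs)"
proof -
  have "connected_on r (B \<union> set xs - {v})" for v
  proof (cases "v \<in> set xs")
    case True
    then obtain as bs where xs_eq: "xs = as @ v # bs" by (auto dest: split_list)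
    have path: "connected_on r (set as)" "connected_on r (set bs)"
      using xs r by (auto simp: xs_eq successively_append_iff successively_Cons
          intro: connected_on_path)
    have "connected_on r (B - {v} \<union> set as)"
    proof (cases as)
      case (Cons a as')
      then show ?thesis using path connected_on_biconnected_Diff[OF B] ends xs
        by (intro connected_on_Un) (auto simp: xs_eq)
    qed (simp add: connected_on_biconnected_Diff B)
    then have "connected_on r (B - {v} \<union> set as \<union> set bs)"
    proof (cases "bs = []")
      case False
      then have "last bs \<in> set bs" "last bs \<in> B" "last bs \<noteq> v"
        using ends xs by (auto simp: xs_eq)
      then have "(B - {v} \<union> set as) \<inter> set bs \<noteq> {}" by blast
      with path \<open>connected_on r (B - {v} \<union> set as)\<close> show ?thesis
        by (intro connected_on_Un[of r "B - {v} \<union> set as"])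
    qed simp
    moreover have "B \<union> set xs - {v} = B - {v} \<union> set as \<union> set bs"
      using xs by (auto simp: xs_eq)
    ultimately show ?thesis by simp
  next
    case False
    then have "hd xs \<noteq> v" using xs by auto
    then have "connected_on r (B - {v} \<union> set xs)"
      using connected_on_biconnected_Diff[OF B] xs ends r
      by (intro connected_on_Un connected_on_path) auto
    with False show ?thesis by (simp add: Un_Diff)
  qed
  moreover have "connected_on r (B \<union> set xs)"
    using B xs ends r by (intro connected_on_Un connected_on_path) (auto simp: biconnected_on_def)
  ultimately show ?thesis using B by (auto simp: biconnected_on_def)
qed

lemma rtrancl_path_in:
  assumes "(u, v) \<in> r\<^sup>*"
  obtains xs where "path_in r xs" "xs \<noteq> []" "hd xs = u" "last xs = v"
proof -
  from assms have "\<exists>xs. path_in r xs \<and> xs \<noteq> [] \<and> hd xs = u \<and> last xs = v"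
  proof (induction rule: converse_rtrancl_induct)
    case base
    show ?case by (intro exI[of _ "[v]"]) simp
  next
    case (step y z)
    then obtain xs where xs: "path_in r xs" "xs \<noteq> []" "hd xs = z" "last xs = v" by blast
    show ?case
    \<comment> \<open>If the new first vertex is already on the path, the path is cut back to its
      suffix from that vertex, so the vertices stay distinct.\<close>
    proof (cases "y \<in> set xs")
      case True
      then obtain as bs where "xs = as @ y # bs" by (auto dest: split_list)
      with xs show ?thesis
        by (intro exI[of _ "y # bs"]) (auto simp: successively_append_iff)
    next
      case False
      with xs step show ?thesis
        by (intro exI[of _ "y # xs"]) (auto simp: successively_Cons)
    qed
  qed
  then show ?thesis using that by blast
qed

lemma successively_Restr:
  assumes "successively (\<lambda>x y. (x, y) \<in> Restr r W) xs" "hd xs \<in> W"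
  shows "set xs \<subseteq> W" "successively (\<lambda>x y. (x, y) \<in> r) xs"
  using assms by (induction xs) (auto simp: successively_Cons)

lemma connected_on_path_in:
  assumes "connected_on r W" "u \<in> W" "v \<in> W"
  obtains xs where "path_in r xs" "xs \<noteq> []" "hd xs = u" "last xs = v" "set xs \<subseteq> W"
proof -
  have "(u, v) \<in> (Restr r W)\<^sup>*" using assms by (auto simp: connected_on_def)
  then obtain xs where "path_in (Restr r W) xs" "xs \<noteq> []" "hd xs = u" "last xs = v"
    by (rule rtrancl_path_in)
  with successively_Restr[of r W xs] assms show ?thesis by (intro that) auto
qed

lemma connected_on_boundary:
  assumes "connected_on r W" "u \<in> W" "u \<in> D" "v \<in> W" "v \<notin> D"
  obtains x y where "x \<in> W" "x \<in> D" "y \<in> W" "y \<notin> D" "(x, y) \<in> r"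
proof -
  have "(u, v) \<in> (Restr r W)\<^sup>*" using assms by (auto simp: connected_on_def)
  then have "v \<in> D \<or> (\<exists>x y. x \<in> W \<and> x \<in> D \<and> y \<in> W \<and> y \<notin> D \<and> (x, y) \<in> r)"
    by (induction rule: rtrancl_induct) (use assms in auto)
  with assms that show ?thesis by blast
qed

subsection \<open>Homogeneous linear systems\<close>

text \<open>Gaussian elimination with more unknowns than equations, by induction on the equations:
  one equation and one unknown are removed at a time.\<close>

lemma homogeneous_system_nontrivial:
  fixes a :: "'i \<Rightarrow> 's \<Rightarrow> real"
  assumes "finite S" "finite I" "card S < card I"
  shows "\<exists>c. (\<exists>i\<in>I. c i \<noteq> 0) \<and> (\<forall>s\<in>S. (\<Sum>i\<in>I. c i * a i s) = 0)"
  using assms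
proof (induction S arbitrary: I a rule: finite_induct)
  case empty
  then have "I \<noteq> {}" by auto
  then show ?case by (intro exI[of _ "\<lambda>_. 1"]) auto
next
  case (insert s S)
  show ?case
  proof (cases "\<forall>i\<in>I. a i s = 0")
    case True
    obtain c where "\<exists>i\<in>I. c i \<noteq> 0" "\<forall>s\<in>S. (\<Sum>i\<in>I. c i * a i s) = 0"
      using insert.IH[of I a] insert.prems insert.hyps by auto
    with True show ?thesis by (intro exI[of _ c]) auto
  next
    case False
    then obtain k where k: "k \<in> I" "a k s \<noteq> 0" by auto
    \<comment> \<open>Coefficients after eliminating the pivot unknown \<open>k\<close>; those of
      equation \<open>s\<close> become 0.\<close>
    define b where "b i x = a i x - a i s / a k s * a k x" for i x
    have "card S < card (I - {k})" using insert.prems insert.hyps k by simp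
    then obtain c where c: "\<exists>i\<in>I - {k}. c i \<noteq> 0" "\<forall>x\<in>S. (\<Sum>i\<in>I - {k}. c i * b i x) = 0"
      using insert.IH[of "I - {k}" b] insert.prems by auto
    \<comment> \<open>The value at \<open>k\<close> is what equation \<open>s\<close> dictates once
      the other unknowns are given by \<open>c\<close>.\<close>
    define d where "d = c(k := - (\<Sum>i\<in>I - {k}. c i * (a i s / a k s)))"
    have "(\<Sum>i\<in>I. d i * a i x) = (\<Sum>i\<in>I - {k}. c i * b i x)" for x
    proof -
      have "(\<Sum>i\<in>I. d i * a i x) = d k * a k x + (\<Sum>i\<in>I - {k}. c i * a i x)"
        using k insert.prems by (subst sum.remove[of _ k]) (auto simp: d_def)
      also have "\<dots> = (\<Sum>i\<in>I - {k}. c i * b i x)"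
        by (simp add: d_def b_def sum_distrib_right sum_distrib_left sum_subtractf algebra_simps)
      finally show ?thesis .
    qed
    moreover have "(\<Sum>i\<in>I - {k}. c i * b i s) = 0" using k by (simp add: b_def)
    moreover have "\<exists>i\<in>I. d i \<noteq> 0" using c by (auto simp: d_def)
    ultimately show ?thesis using c by (intro exI[of _ d]) auto
  qed
qed


subsection \<open>Cycles and convex sets in chordal graphs\<close>

abbreviation cycle_in :: "'a rel \<Rightarrow> 'a list \<Rightarrow> bool" where
  "cycle_in r xs \<equiv> path_in r xs \<and> 3 \<le> length xs \<and> (last xs, hd xs) \<in> r"

text \<open>Pairs each vertex with its cyclic successor, so the last arc is the closing one. Vertex
  lists make cutting a cycle along a chord a matter of splitting lists, while
  \<open>graph_cycle\<close> speaks of arc lists.\<close>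

definition cyclic_arcs :: "'a list \<Rightarrow> ('a \<times> 'a) list" where
  "cyclic_arcs xs = zip xs (tl xs @ [hd xs])"

lemma length_cyclic_arcs: "xs \<noteq> [] \<Longrightarrow> length (cyclic_arcs xs) = length xs"
  by (simp add: cyclic_arcs_def)

lemma cycle_verts_cyclic_arcs: "xs \<noteq> [] \<Longrightarrow> cycle_verts (cyclic_arcs xs) = set xs"
  by (simp add: cyclic_arcs_def cycle_verts_def flip: set_map)

text \<open>Together with the next lemma this shows that an edge that is not an arc of the cycle in
  either direction has cycle vertices strictly on both sides.\<close>

lemma in_cyclic_arcs_consecutive: "(a, b) \<in> set (cyclic_arcs (as @ a # b # bs))"
  by (auto simp: cyclic_arcs_def in_set_zip nth_append nth_tl intro!: exI[of _ "length as"])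

lemma in_cyclic_arcs_closing: "(b, a) \<in> set (cyclic_arcs (a # bs @ [b]))"
proof -
  have "zip (a # bs @ [b]) (bs @ [b, a]) = zip (a # bs) (bs @ [b]) @ [(b, a)]"
    using zip_append[of "a # bs" "bs @ [b]" "[b]" "[a]"] by simp
  then show ?thesis by (simp add: cyclic_arcs_def)
qed

lemma pcas_zip: "pcas x (zip (x # xs) (xs @ [z])) z"
  by (induction xs arbitrary: x) auto

lemma pawalk_verts_zip: "pawalk_verts x (zip (x # xs) (xs @ [z])) = x # xs @ [z]"
  by (induction xs arbitrary: x) auto

lemma set_zip_subset_iff:
  "set (zip (x # xs) (xs @ [z])) \<subseteq> r \<longleftrightarrow> successively (\<lambda>x y. (x, y) \<in> r) (x # xs @ [z])"
  by (induction xs arbitrary: x) auto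

lemma pcas_successively:
  "pcas u c v \<Longrightarrow> set c \<subseteq> r \<Longrightarrow> successively (\<lambda>x y. (x, y) \<in> r) (map fst c)"
proof (induction c arbitrary: u)
  case (Cons e es)
  then show ?case by (cases es; cases e) auto
qed simp

context pair_graph
begin

lemma sym_parcs: "sym (parcs G)"
  using sym_arcs by (simp add: symmetric_def)

lemma graph_cycle_cyclic_arcs:
  assumes "cycle_in (parcs G) xs"
  shows "graph_cycle G (cyclic_arcs xs)"
proof -
  obtain x ys where xs: "xs = x # ys" using assms by (cases xs) auto
  have arcs: "cyclic_arcs xs = zip (x # ys) (ys @ [x])" by (simp add: xs cyclic_arcs_def)
  have "successively (\<lambda>x y. (x, y) \<in> parcs G) (x # ys @ [x])"
    using assms by (auto simp: xs successively_append_iff successively_Cons split: if_splits)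
  then have "set (cyclic_arcs xs) \<subseteq> parcs G" unfolding arcs set_zip_subset_iff .
  moreover have "x \<in> pverts G"
    using assms by (auto simp: xs dest: wellformed')
  ultimately have "awalk x (cyclic_arcs xs) x"
    unfolding awalk_def arcs by (simp only: pcas_zip simp_thms)
  moreover have "distinct (tl (pawalk_verts x (cyclic_arcs xs)))"
    unfolding arcs pawalk_verts_zip using assms by (simp add: xs)
  ultimately have "cycle (cyclic_arcs xs)"
    unfolding cycle_def using length_cyclic_arcs[of xs] by (auto simp: xs)
  then show ?thesis using assms length_cyclic_arcs[of xs] by (auto simp: xs graph_cycle_def)
qed

lemma graph_cycle_cycle_in:
  assumes "graph_cycle G c"
  shows "cycle_in (parcs G) (map fst c)"
proof -
  obtain u where u: "awalk u c u" "distinct (tl (pawalk_verts u c))" "length c \<ge> 3"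
    using assms by (auto simp: graph_cycle_def cycle_def)
  have cas: "pcas u c u" "set c \<subseteq> parcs G" using u by (auto simp: awalk_def)
  obtain e es where c: "c = e # es" using u by (cases c) auto
  have verts: "pawalk_verts u c = map fst c @ [snd (last c)]"
    using u by (auto simp: awalk_verts_conv)
  have ends: "fst e = u" "snd (last c) = u"
    using cas awlast_of_awalk[OF u(1)] verts by (auto simp: c)
  have "last c \<in> parcs G" using cas by (auto simp: c)
  then have "(fst (last c), u) \<in> parcs G" using ends by (metis prod.collapse)
  moreover have "last (map fst c) = fst (last c)" using c by (intro last_map) simp
  \<comment> \<open>The vertex list of the closed walk has \<open>u\<close> at both ends; its tail
    is a rotation of \<open>map fst c\<close>.\<close>
  moreover have "distinct (map fst es @ [u])"
    using u(2) unfolding verts ends(2) by (simp add: c)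
  then have "distinct (map fst c)" using ends by (simp add: c)
  ultimately show ?thesis
    using u ends pcas_successively[OF cas] by (auto simp: c)
qed

text \<open>By chordality the subgraph \<open>cycle_graph\<close> of the cycle is not induced, so
  some edge joins two cycle vertices without being a cycle arc in either direction. Its ends are
  therefore neither consecutive in the list nor its first and last entries, which makes both gaps
  nonempty.\<close>

lemma chordal_chord:
  assumes "chordal G" "cycle_in (parcs G) xs" "length xs > 3"
  obtains as a bs b cs where "xs = as @ a # bs @ b # cs" "bs \<noteq> []" "as @ cs \<noteq> []" "(a, b) \<in> parcs G"
proof -
  note chordI = that
  let ?c = "cyclic_arcs xs"
  let ?H = "cycle_graph ?c"
  have ne: "xs \<noteq> []" using assms by auto
  have c: "graph_cycle G ?c" "length ?c > 3"
    using assms graph_cycle_cyclic_arcs length_cyclic_arcs[OF ne] by auto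
  have arcs: "set ?c \<subseteq> parcs G"
    using c by (auto simp: graph_cycle_def cycle_def awalk_def)
  have verts: "cycle_verts ?c = set xs" by (rule cycle_verts_cyclic_arcs[OF ne])
  have snd: "snd ` set ?c \<subseteq> set xs" using ne
    by (auto simp: cyclic_arcs_def dest!: set_zip_rightD intro: list.set_sel)
  have fst: "fst ` set ?c \<subseteq> set xs" using verts by (simp add: cycle_verts_def)
  have "pair_wf_digraph ?H"
    using fst snd by unfold_locales (auto simp: cycle_graph_def verts)
  moreover have "set xs \<subseteq> pverts G"
    unfolding verts[symmetric] cycle_verts_def using arcs by (auto intro!: arc_fst_in_verts)
  ultimately have "subgraph ?H G"
    using arcs arcs_symmetric wf_digraph
    by (auto simp: subgraph_def wf_digraph_wp_iff cycle_graph_def verts)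
  moreover have "\<not> induced_subgraph ?H G"
    using assms(1) c by (auto simp: chordal_def)
  ultimately have "set ?c \<union> (set ?c)\<inverse> \<noteq> {e \<in> parcs G. fst e \<in> set xs \<and> snd e \<in> set xs}"
    by (simp add: induced_subgraph_def cycle_graph_def verts)
  moreover have "set ?c \<union> (set ?c)\<inverse> \<subseteq> {e \<in> parcs G. fst e \<in> set xs \<and> snd e \<in> set xs}"
    using arcs fst snd by (auto intro: arcs_symmetric)
  ultimately obtain e where
    "e \<in> {e \<in> parcs G. fst e \<in> set xs \<and> snd e \<in> set xs}" "e \<notin> set ?c \<union> (set ?c)\<inverse>"
    by blast
  then obtain a b where ab: "(a, b) \<in> parcs G" "a \<in> set xs" "b \<in> set xs"
    "(a, b) \<notin> set ?c" "(b, a) \<notin> set ?c"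
    by (cases e) auto
  have "a \<noteq> b" using ab no_loops' by auto
  have chord: thesis
    if "xs = as @ x # bs @ y # cs" "(x, y) \<in> parcs G" "(x, y) \<notin> set ?c" "(y, x) \<notin> set ?c"
    for x y as bs cs
  proof -
    have "bs \<noteq> []" using that in_cyclic_arcs_consecutive[of x y as cs] by auto
    moreover have "as @ cs \<noteq> []" using that in_cyclic_arcs_closing[of y x bs] by auto
    ultimately show thesis using that chordI by blast
  qed
  obtain as bs where xs: "xs = as @ a # bs" using ab by (auto dest: split_list)
  with ab \<open>a \<noteq> b\<close> consider "b \<in> set as" | "b \<in> set bs" by auto
  then show thesis
  proof cases
    case 1
    then obtain as1 as2 where "as = as1 @ b # as2" by (auto dest: split_list)
    with xs have "xs = as1 @ b # as2 @ a # bs" by simp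
    then show thesis using chord ab arcs_symmetric by blast
  next
    case 2
    then obtain bs1 bs2 where "bs = bs1 @ b # bs2" by (auto dest: split_list)
    with xs have "xs = as @ a # bs1 @ b # bs2" by simp
    then show thesis using chord ab by blast
  qed
qed

lemma successively_subset_pverts:
  "successively (\<lambda>x y. (x, y) \<in> parcs G) xs \<Longrightarrow> hd xs \<in> pverts G \<Longrightarrow> set xs \<subseteq> pverts G"
  by (induction xs) (auto simp: successively_Cons dest: wellformed')

lemma cc_convex_cycle:
  assumes "cc_convex G X" "cycle_in (parcs G) xs"
  shows "set xs - X \<noteq> {v}"
proof
  assume eq: "set xs - X = {v}"
  have "cycle_verts (cyclic_arcs xs) = set xs"
    using assms by (intro cycle_verts_cyclic_arcs) auto
  moreover have "v \<in> pverts G"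
  proof -
    have "set xs \<subseteq> pverts G"
      using assms by (intro successively_subset_pverts) (auto dest: wellformed')
    then show ?thesis using eq by blast
  qed
  ultimately have "v \<in> I_cc G X"
    using eq graph_cycle_cyclic_arcs[OF assms(2)] unfolding I_cc_def by blast
  then show False using assms(1) eq by (auto simp: cc_convex_def)
qed

text \<open>
  A chord splits the cycle in two. The part that keeps the edge joining the ends is treated first;
  it places the chord inside \<open>X\<close>, so the induction hypothesis applies to the other part.
\<close>

lemma cycle_subset_cc_convex:
  assumes "chordal G" "cc_convex G X"
  shows "cycle_in (parcs G) xs \<Longrightarrow> hd xs \<in> X \<Longrightarrow> last xs \<in> X \<Longrightarrow> set xs \<subseteq> X"
proof (induction "length xs" arbitrary: xs rule: less_induct)
  case less
  show ?case
  proof (cases "length xs > 3")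
    case False
    with less.prems have "length xs = 3" by linarith
    then obtain a b c where xs: "xs = [a, b, c]" by (auto simp: length_Suc_conv numeral_3_eq_3)
    \<comment> \<open>In a triangle whose ends lie in \<open>X\<close>, only the middle vertex could
      be missing, and convexity supplies it.\<close>
    then have "set xs - X = {b}" if "b \<notin> X" using that less.prems by auto
    with cc_convex_cycle[OF assms(2) less.prems(1)] have "b \<in> X" by blast
    then show ?thesis using xs less.prems by auto
  next
    case True
    obtain as a bs b cs where xs: "xs = as @ a # bs @ b # cs" and ne: "bs \<noteq> []" "as @ cs \<noteq> []"
      and ab: "(a, b) \<in> parcs G"
      using chordal_chord[OF assms(1) less.prems(1) True] by metis
    let ?outer = "as @ a # b # cs" and ?inner = "a # bs @ [b]"
    have len: "length ?outer < length xs" "length ?inner < length xs" "3 \<le> length ?outer"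
      using ne by (auto simp: xs Suc_le_eq numeral_3_eq_3)
    have hl: "hd ?outer = hd xs" "last ?outer = last xs"
      by (auto simp: xs hd_append)
    have "cycle_in (parcs G) ?outer"
      using less.prems len hl ab
      by (auto simp: xs successively_append_iff successively_Cons)
    then have outer: "set ?outer \<subseteq> X" using less.hyps[OF len(1)] less.prems hl by simp
    have "cycle_in (parcs G) ?inner"
      using less.prems ne ab
      by (auto simp: xs successively_append_iff successively_Cons Suc_le_eq numeral_3_eq_3
          intro: arcs_symmetric)
    then have "set ?inner \<subseteq> X" using less.hyps[OF len(2)] outer by simp
    with outer show ?thesis by (auto simp: xs)
  qed
qed

end

section \<open>Biconnected sets that share an edge with a convex set\<close>

lemma connected_on_component:
  assumes "sym r"
  shows "connected_on r {y. (u, y) \<in> (Restr r W)\<^sup>*}" (is "connected_on r ?D")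
proof -
  have reach: "(u, y) \<in> (Restr r ?D)\<^sup>*" if "(u, y) \<in> (Restr r W)\<^sup>*" for y
    using that
  proof (induction rule: rtrancl_induct)
    case (step y z)
    then have "(y, z) \<in> Restr r ?D" by (auto intro: rtrancl_into_rtrancl)
    with step show ?case by (auto intro: rtrancl_into_rtrancl)
  qed simp
  have "sym (Restr r ?D)" using assms by (auto simp: sym_def)
  then have "sym ((Restr r ?D)\<^sup>*)" by (rule sym_rtrancl)
  with reach show ?thesis unfolding connected_on_def by (auto intro: rtrancl_trans dest: symD)
qed

context pair_graph
begin

text \<open>Otherwise an edge leaves the component \<open>D\<close> of \<open>u\<close> in
  \<open>B \<inter> X\<close> towards a vertex \<open>x\<close> of \<open>B\<close> outside
  \<open>X\<close>. Biconnectivity leads from \<open>x\<close> back to \<open>D\<close> while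
  avoiding the vertex \<open>d\<close> where it was left, and \<open>D\<close> is connected. The
  resulting cycle has an edge in \<open>X\<close> and passes through \<open>x\<close>, contradicting
  \<open>cycle_subset_cc_convex\<close>.\<close>

lemma biconnected_subset_cc_convex:
  assumes G: "chordal G" and X: "cc_convex G X" and B: "biconnected_on (parcs G) B"
    and uw: "u \<in> B \<inter> X" "w \<in> B \<inter> X" "(u, w) \<in> parcs G"
  shows "B \<subseteq> X"
proof (rule ccontr)
  assume "\<not> B \<subseteq> X"
  then obtain z where z: "z \<in> B" "z \<notin> X" by auto
  define D where "D = {y. (u, y) \<in> (Restr (parcs G) (B \<inter> X))\<^sup>*}"
  have D: "connected_on (parcs G) D"
    unfolding D_def by (rule connected_on_component[OF sym_parcs])
  have "D \<subseteq> B \<inter> X"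
  proof
    fix y assume "y \<in> D"
    then have "(u, y) \<in> (Restr (parcs G) (B \<inter> X))\<^sup>*" by (simp add: D_def)
    then show "y \<in> B \<inter> X" by (induction rule: rtrancl_induct) (use uw in auto)
  qed
  have uwD: "u \<in> D" "w \<in> D" "u \<noteq> w" using uw no_loops' by (auto simp: D_def)
  obtain d x where d: "d \<in> D" and x: "x \<in> B" "x \<notin> D" "(d, x) \<in> parcs G"
  proof (rule connected_on_boundary[of "parcs G" B u D z])
    show "connected_on (parcs G) B" using B by (simp add: biconnected_on_def)
  qed (use uwD uw z \<open>D \<subseteq> B \<inter> X\<close> in auto)
  have "x \<notin> X"
  proof
    assume "x \<in> X"
    then have "(d, x) \<in> Restr (parcs G) (B \<inter> X)" using d x \<open>D \<subseteq> B \<inter> X\<close> by auto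
    then have "x \<in> D" using d by (auto simp: D_def intro: rtrancl_into_rtrancl)
    with x show False by blast
  qed
  \<comment> \<open>The edge from \<open>u\<close> to \<open>w\<close> ensures that \<open>D\<close>
    has a vertex other than \<open>d\<close>, to which the walk from \<open>x\<close> can
    return.\<close>
  obtain d2 where d2: "d2 \<in> D" "d2 \<noteq> d" using uwD by metis
  have "x \<in> B - {d}" "d2 \<in> B - {d}" using x d d2 \<open>D \<subseteq> B \<inter> X\<close> by auto
  then obtain P where P: "path_in (parcs G) P" "P \<noteq> []" "hd P = x" "last P = d2" "set P \<subseteq> B - {d}"
    using connected_on_path_in[OF connected_on_biconnected_Diff[OF B]] by metis
  have "\<exists>y\<in>set P. y \<in> D" using P d2 last_in_set by blast
  \<comment> \<open>Stopping at the first vertex \<open>d'\<close> in \<open>D\<close> keeps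
    \<open>as\<close> disjoint from \<open>D\<close>, hence from the return path inside
    \<open>D\<close>.\<close>
  then obtain as d' bs where P_eq: "P = as @ d' # bs" and d': "d' \<in> D" "\<forall>a\<in>set as. a \<notin> D"
    using split_list_first_prop[of P "\<lambda>y. y \<in> D"] by blast
  have as: "as \<noteq> []" "hd as = x" using P x d' by (auto simp: P_eq hd_append split: if_splits)
  have "d' \<noteq> d" using P by (auto simp: P_eq)
  obtain R where R: "path_in (parcs G) R" "R \<noteq> []" "hd R = d'" "last R = d" "set R \<subseteq> D"
    using connected_on_path_in[OF D d'(1) d] by metis
  obtain Q where R_eq: "R = Q @ [d]" using R append_butlast_last_id by metis
  have Q: "Q \<noteq> []" "hd Q = d'" using R \<open>d' \<noteq> d\<close> by (auto simp: R_eq hd_append split: if_splits)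
  \<comment> \<open>Since \<open>R\<close> ends in \<open>d\<close>, the edge closing this list
    joins two vertices of \<open>D\<close>, as the cycle lemma requires.\<close>
  let ?C = "d # as @ Q"
  have "cycle_in (parcs G) ?C"
    using P R Q as d' d x
    by (auto simp: P_eq R_eq successively_append_iff successively_Cons Suc_le_eq numeral_3_eq_3
        neq_Nil_conv)
  moreover have "last Q \<in> D" using last_in_set[OF Q(1)] R by (simp add: R_eq subset_iff)
  then have "hd ?C \<in> X" "last ?C \<in> X" using d Q \<open>D \<subseteq> B \<inter> X\<close> by auto
  ultimately have "set ?C \<subseteq> X" by (rule cycle_subset_cc_convex[OF G X])
  with as \<open>x \<notin> X\<close> show False using hd_in_set[of as] by auto
qed

end

subsection \<open>Blocks as vertex sets\<close>

context pair_graph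
begin

text \<open>Blocks represented by their vertex sets; \<open>blocks_eq\<close> later identifies them
  with the maximal subgraphs in \<open>blocks\<close>.\<close>

definition block_verts :: "'a set set" where
  "block_verts = {W. W \<subseteq> pverts G \<and> biconnected_on (parcs G) W \<and>
    (\<forall>W'. W' \<subseteq> pverts G \<and> biconnected_on (parcs G) W' \<and> W \<subseteq> W' \<longrightarrow> W' = W)}"

lemma finite_block_verts: "finite block_verts"
  by (rule finite_subset[of _ "Pow (pverts G)"]) (auto simp: block_verts_def pair_finite_verts)

lemma block_verts_subset: "B \<in> block_verts \<Longrightarrow> B \<subseteq> pverts G"
  and block_verts_biconnected: "B \<in> block_verts \<Longrightarrow> biconnected_on (parcs G) B"
  by (auto simp: block_verts_def)

lemma block_verts_maximal:
  "B \<in> block_verts \<Longrightarrow> W \<subseteq> pverts G \<Longrightarrow> biconnected_on (parcs G) W \<Longrightarrow> B \<subseteq> W \<Longrightarrow> W = B"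
  by (simp add: block_verts_def)

lemma biconnected_in_block:
  assumes "biconnected_on (parcs G) W" "W \<subseteq> pverts G"
  obtains B where "B \<in> block_verts" "W \<subseteq> B"
proof -
  let ?A = "{W. W \<subseteq> pverts G \<and> biconnected_on (parcs G) W}"
  have "finite ?A" by (rule finite_subset[of _ "Pow (pverts G)"]) (auto simp: pair_finite_verts)
  then obtain B where B: "B \<in> ?A" "W \<subseteq> B" "\<forall>W'\<in>?A. B \<subseteq> W' \<longrightarrow> B = W'"
    using finite_has_maximal2[of ?A W] assms by auto
  then show thesis by (intro that[of B]) (auto simp: block_verts_def)
qed

lemma block_verts_Int:
  assumes "B \<in> block_verts" "B' \<in> block_verts" "x \<in> B \<inter> B'" "y \<in> B \<inter> B'" "x \<noteq> y"
  shows "B = B'"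
proof -
  have "biconnected_on (parcs G) (B \<union> B')"
    using assms by (intro biconnected_on_Un[of _ B B' x y] block_verts_biconnected)
  then show ?thesis
    using assms block_verts_maximal[of _ "B \<union> B'"] block_verts_subset by blast
qed

text \<open>The path is an ear on \<open>B\<close>, so maximality of \<open>B\<close> absorbs
  it.\<close>

lemma block_verts_path:
  assumes "B \<in> block_verts" "path_in (parcs G) xs" "xs \<noteq> []"
    and "hd xs \<in> B" "last xs \<in> B" "hd xs \<noteq> last xs"
  shows "set xs \<subseteq> B"
proof -
  have "biconnected_on (parcs G) (B \<union> set xs)"
    using assms by (intro biconnected_on_ear sym_parcs block_verts_biconnected)
  moreover have "B \<union> set xs \<subseteq> pverts G"
    using assms block_verts_subset successively_subset_pverts[of xs] by auto
  ultimately show ?thesis using assms(1) block_verts_maximal[of B "B \<union> set xs"] by auto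
qed

text \<open>The vertex list is an ear on the closing edge, so the vertices of the cycle form a
  biconnected set.\<close>

lemma cycle_in_block:
  assumes "cycle_in (parcs G) xs"
  obtains B where "B \<in> block_verts" "set xs \<subseteq> B"
proof -
  have ne: "hd xs \<noteq> last xs" "xs \<noteq> []" using assms no_loops' by force+
  have "biconnected_on (parcs G) ({last xs, hd xs} \<union> set xs)"
    using assms ne by (intro biconnected_on_ear biconnected_on_edge sym_parcs) auto
  moreover have "{last xs, hd xs} \<union> set xs \<subseteq> pverts G"
    using assms successively_subset_pverts[of xs] by (auto dest: wellformed')
  ultimately show thesis using that biconnected_in_block by (metis le_sup_iff)
qed

lemma block_verts_labelling:
  assumes B: "B \<in> block_verts"
  shows "\<exists>t :: 'a \<Rightarrow> real. inj_on t B \<and> (\<forall>B'\<in>block_verts - {B}. \<forall>x\<in>B'. \<forall>y\<in>B'. t x = t y)"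
proof -
  txt \<open>Two vertices of \<open>B\<close> joined by a path without arcs inside \<open>B\<close> would give
    an ear, so removing these arcs puts the vertices of \<open>B\<close> into different components.\<close>
  define K where "K = parcs G - B \<times> B"
  define cls where "cls v = K\<^sup>* `` {v}" for v
  \<comment> \<open>Numbering the finitely many reachability classes turns them into real
    labels.\<close>
  obtain h :: "'a set \<Rightarrow> nat" where h: "inj_on h (cls ` pverts G)"
    using finite_imp_inj_to_nat_seg[of "cls ` pverts G"] pair_finite_verts by blast
  define t where "t v = real (h (cls v))" for v
  have "x = y" if xy: "x \<in> B" "y \<in> B" "t x = t y" for x y
  proof (rule ccontr)
    assume "x \<noteq> y"
    have "cls x = cls y"
      using xy h block_verts_subset[OF B] by (auto simp: t_def dest: inj_onD)
    moreover have "y \<in> cls y" by (simp add: cls_def)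
    ultimately have "(x, y) \<in> K\<^sup>*" by (auto simp: cls_def)
    then obtain xs where xs: "path_in K xs" "xs \<noteq> []" "hd xs = x" "last xs = y"
      by (rule rtrancl_path_in)
    have "successively (\<lambda>x y. (x, y) \<in> parcs G) xs"
      using xs(1) by (auto simp: K_def elim: successively_mono)
    with B xs xy \<open>x \<noteq> y\<close> have "set xs \<subseteq> B" by (intro block_verts_path) auto
    \<comment> \<open>The first arc of the path has both ends in \<open>B\<close>, but
      \<open>K\<close> contains no such arc.\<close>
    moreover obtain a b ys where "xs = a # b # ys"
      using xs \<open>x \<noteq> y\<close> by (metis last.simps list.exhaust list.sel(1))
    ultimately show False using xs by (auto simp: K_def)
  qed
  then have "inj_on t B" by (rule inj_onI)
  moreover have "t x = t y" if B': "B' \<in> block_verts" "B' \<noteq> B" and xy: "x \<in> B'" "y \<in> B'" for B' x y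
  proof -
    \<comment> \<open>Distinct blocks share at most one vertex and there are no loops, so no arc of
      \<open>B'\<close> was removed.\<close>
    have "Restr (parcs G) B' \<subseteq> K"
      using block_verts_Int[OF B B'(1)] B'(2) no_loops' by (auto simp: K_def)
    then have "(Restr (parcs G) B')\<^sup>* \<subseteq> K\<^sup>*" by (rule rtrancl_mono)
    then have "(x, y) \<in> K\<^sup>*" "(y, x) \<in> K\<^sup>*"
      using block_verts_biconnected[OF B'(1)] xy by (auto simp: biconnected_on_def connected_on_def)
    then have "cls x = cls y" by (auto simp: cls_def intro: rtrancl_trans)
    then show ?thesis by (simp add: t_def)
  qed
  ultimately show ?thesis by blast
qed

text \<open>A one-vertex block would be properly contained in an edge at that vertex, which is
  biconnected.\<close>

lemma block_verts_two_elements: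
  assumes conn: "connected_on (parcs G) (pverts G)" and card: "card (pverts G) \<ge> 2"
    and B: "B \<in> block_verts"
  obtains x y where "x \<in> B" "y \<in> B" "x \<noteq> y"
proof -
  obtain x where x: "x \<in> B" using block_verts_biconnected[OF B] by (auto simp: biconnected_on_def)
  have "\<exists>y\<in>B. y \<noteq> x"
  proof (rule ccontr)
    assume "\<not> ?thesis"
    then have B_eq: "B = {x}" using x by blast
    have xV: "x \<in> pverts G" using B x block_verts_subset by auto
    obtain z where z: "z \<in> pverts G" "z \<noteq> x"
      using card card_le_Suc0_iff_eq[OF pair_finite_verts] xV by (metis not_less_eq_eq numeral_2_eq_2)
    obtain a y where "(x, y) \<in> parcs G" "y \<noteq> x"
      using connected_on_boundary[OF conn xV, of "{x}" z] z by auto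
    then have "{x, y} = B"
      using B B_eq by (intro block_verts_maximal biconnected_on_edge sym_parcs) (auto dest: wellformed')
    with B_eq \<open>y \<noteq> x\<close> show False by auto
  qed
  with x that show thesis by blast
qed

end

subsection \<open>Bounds on the size of hull sets\<close>

context pair_graph
begin

lemma card_hull_set_ge:
  assumes conn: "connected_on (parcs G) (pverts G)" and card: "card (pverts G) \<ge> 2"
    and S: "hull_set G S"
  shows "card block_verts + 1 \<le> card S"
proof (rule ccontr)
  assume "\<not> ?thesis"
  then have less: "card S \<le> card block_verts" by simp
  have S': "S \<subseteq> pverts G" "cc_hull G S = pverts G" using S by (auto simp: hull_set_def)
  have fin: "finite S" using S' pair_finite_verts finite_subset by blast
  have "pverts G \<noteq> {}" using card by auto
  then obtain z where z: "z \<in> pverts G" by auto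
  have "biconnected_on (parcs G) {z}" by (simp add: biconnected_on_def connected_on_def)
  then have "block_verts \<noteq> {}" using z biconnected_in_block[of "{z}"] by auto
  then have pos: "card block_verts > 0" using finite_block_verts by (simp add: card_gt_0_iff)
  \<comment> \<open>The equation at \<open>s0\<close> will hold automatically, which leaves fewer
    equations than unknowns. For empty \<open>S\<close> the point \<open>s0\<close> is
    arbitrary.\<close>
  obtain s0 where s0: "card (S - {s0}) < card block_verts"
  proof (cases "S = {}")
    case True
    then show thesis using pos that by auto
  next
    case False
    then obtain s where "s \<in> S" by auto
    then have "card (S - {s}) < card S" using fin by (intro psubset_card_mono) auto
    with less show thesis by (intro that[of s]) auto
  qed
  obtain t :: "'a set \<Rightarrow> 'a \<Rightarrow> real" where t:
    "\<And>B. B \<in> block_verts \<Longrightarrow> inj_on (t B) B"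
    "\<And>B B' x y. B \<in> block_verts \<Longrightarrow> B' \<in> block_verts \<Longrightarrow> B' \<noteq> B \<Longrightarrow> x \<in> B' \<Longrightarrow> y \<in> B' \<Longrightarrow>
      t B x = t B y"
  proof -
    have "\<forall>B\<in>block_verts. \<exists>t :: 'a \<Rightarrow> real. inj_on t B \<and>
        (\<forall>B'\<in>block_verts - {B}. \<forall>x\<in>B'. \<forall>y\<in>B'. t x = t y)"
      using block_verts_labelling by blast
    then obtain t :: "'a set \<Rightarrow> 'a \<Rightarrow> real" where "\<forall>B\<in>block_verts. inj_on (t B) B \<and>
        (\<forall>B'\<in>block_verts - {B}. \<forall>x\<in>B'. \<forall>y\<in>B'. t B x = t B y)"
      by metis
    then show thesis by (intro that[of t]) blast+
  qed
  obtain c where c: "\<exists>B\<in>block_verts. c B \<noteq> 0"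
    "\<forall>s\<in>S - {s0}. (\<Sum>B\<in>block_verts. c B * (t B s - t B s0)) = 0"
    using homogeneous_system_nontrivial[of "S - {s0}" block_verts "\<lambda>B s. t B s - t B s0"]
      fin finite_block_verts s0 by auto
  define f where "f v = (\<Sum>B\<in>block_verts. c B * (t B v - t B s0))" for v
  \<comment> \<open>Within one block all other labels are constant, so only the summand of that
    block contributes to the difference.\<close>
  have f_diff: "f x - f y = c B * (t B x - t B y)" if "B \<in> block_verts" "x \<in> B" "y \<in> B" for B x y
  proof -
    have "f x - f y = (\<Sum>B'\<in>block_verts. c B' * (t B' x - t B' y))"
      by (simp add: f_def algebra_simps flip: sum_subtractf)
    also have "\<dots> = c B * (t B x - t B y) + (\<Sum>B'\<in>block_verts - {B}. c B' * (t B' x - t B' y))"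
      by (rule sum.remove[OF finite_block_verts that(1)])
    also have "(\<Sum>B'\<in>block_verts - {B}. c B' * (t B' x - t B' y)) = 0"
    proof (rule sum.neutral, rule ballI)
      fix B' assume "B' \<in> block_verts - {B}"
      then have "t B' x = t B' y" using t(2)[of B' B x y] that by auto
      then show "c B' * (t B' x - t B' y) = 0" by simp
    qed
    finally show ?thesis by simp
  qed
  have c0: "c B = 0"
    if "B \<in> block_verts" "x \<in> B" "y \<in> B" "x \<noteq> y" "f x = 0" "f y = 0" for B x y
    using f_diff[OF that(1-3)] inj_onD[OF t(1)[OF that(1)], of x y] that by auto
  let ?Z = "{v \<in> pverts G. f v = 0}"
  have "v \<in> ?Z" if v: "v \<in> I_cc G ?Z" for v
  proof (rule ccontr)
    assume nv: "v \<notin> ?Z"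
    then obtain C where C: "graph_cycle G C" "cycle_verts C - ?Z = {v}" and vV: "v \<in> pverts G"
      using v by (auto simp: I_cc_def)
    define xs where "xs = map fst C"
    have xs: "cycle_in (parcs G) xs" "set xs - ?Z = {v}"
      using graph_cycle_cycle_in[OF C(1)] C(2) by (simp_all add: xs_def cycle_verts_def)
    obtain B where B: "B \<in> block_verts" "set xs \<subseteq> B" using cycle_in_block[OF xs(1)] .
    \<comment> \<open>Besides \<open>v\<close> the cycle has two further vertices, both zeros of
      \<open>f\<close> in one block. They force the coefficient of the block to be 0, so
      \<open>f\<close> is constant there and vanishes at \<open>v\<close> too.\<close>
    have "card (set xs) \<ge> 3" using xs(1) by (simp add: distinct_card)
    moreover have "card (set xs - {v}) = card (set xs) - 1" using xs(2) by (intro card_Diff_singleton) auto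
    ultimately have "\<not> card (set xs - {v}) \<le> Suc 0" by simp
    then obtain x y where xy: "x \<in> set xs - {v}" "y \<in> set xs - {v}" "x \<noteq> y"
      using card_le_Suc0_iff_eq[of "set xs - {v}"] by auto
    then have "x \<in> ?Z" "y \<in> ?Z" using xs(2) by auto
    then have "c B = 0" using xy B c0[of B x y] by auto
    moreover have "x \<in> B" "v \<in> B" using xy B xs by auto
    ultimately have "f v = f x" using f_diff[of B v x] B by simp
    with \<open>x \<in> ?Z\<close> nv vV show False by auto
  qed
  then have "I_cc G ?Z \<subseteq> ?Z" by (rule subsetI)
  then have "cc_convex G ?Z" unfolding cc_convex_def by (intro conjI equalityI) (auto simp: I_cc_def)
  moreover have "S \<subseteq> ?Z"
  proof
    fix s assume "s \<in> S"
    then have "f s = 0" using c(2) by (cases "s = s0") (auto simp: f_def)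
    with \<open>s \<in> S\<close> S' show "s \<in> ?Z" by auto
  qed
  ultimately have "pverts G \<subseteq> ?Z" using cc_hull_least S' by metis
  have "c B = 0" if B: "B \<in> block_verts" for B
  proof -
    obtain x y where "x \<in> B" "y \<in> B" "x \<noteq> y" using block_verts_two_elements[OF conn card B] .
    then show ?thesis using c0[of B x y] B block_verts_subset \<open>pverts G \<subseteq> ?Z\<close> by blast
  qed
  with c(1) show False by auto
qed

lemma ex_hull_set_card_le:
  assumes conn: "connected_on (parcs G) (pverts G)" and card: "card (pverts G) \<ge> 2"
    and G: "chordal G"
  obtains S where "hull_set G S" "card S \<le> card block_verts + 1"
proof -
  \<comment> \<open>Instead of ordering the blocks, take a maximal family whose union lies in the
    hull of at most one vertex more than it has blocks. Such a family covers all vertices.\<close>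
  define good where "good F \<longleftrightarrow> F \<subseteq> block_verts \<and> F \<noteq> {} \<and>
    (\<exists>S. finite S \<and> S \<subseteq> pverts G \<and> card S \<le> card F + 1 \<and> \<Union>F \<subseteq> cc_hull G S)" for F
  have fill: "B \<subseteq> cc_hull G S"
    if "B \<in> block_verts" "S \<subseteq> pverts G" "(u, w) \<in> parcs G" "{u, w} \<subseteq> B" "{u, w} \<subseteq> cc_hull G S"
    for B S u w
    using that biconnected_subset_cc_convex[OF G cc_convex_cc_hull block_verts_biconnected, of S B u w]
    by auto
  have edge_block: "\<exists>B\<in>block_verts. {u, w} \<subseteq> B" if "(u, w) \<in> parcs G" for u w
    using that biconnected_in_block[OF biconnected_on_edge[OF sym_parcs that]] wellformed'
    by (metis empty_subsetI insert_subset)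
  \<comment> \<open>The two ends of any edge generate the block of that edge, so one block costs two
    vertices.\<close>
  have ex: "\<exists>F. good F"
  proof -
    obtain x where x: "x \<in> pverts G" using card by fastforce
    obtain y where y: "y \<in> pverts G" "y \<noteq> x"
      using card card_le_Suc0_iff_eq[OF pair_finite_verts] x by (metis not_less_eq_eq numeral_2_eq_2)
    obtain u w where uw: "(u, w) \<in> parcs G"
      using connected_on_boundary[OF conn x, of "{x}" y] y by (metis singletonD singletonI)
    obtain B where "B \<in> block_verts" "{u, w} \<subseteq> B" using edge_block[OF uw] by auto
    moreover have "{u, w} \<subseteq> pverts G" using uw wellformed' by auto
    moreover have "card {u, w} \<le> card {B} + 1" by (simp add: card_insert_if)
    ultimately have "good {B}"
      unfolding good_def using fill[of B "{u, w}" u w] uw cc_hull_superset[of "{u, w}" G]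
      by (intro conjI exI[of _ "{u, w}"]) auto
    then show ?thesis ..
  qed
  have "finite {F. good F}"
    by (rule finite_subset[of _ "Pow block_verts"]) (auto simp: good_def finite_block_verts)
  with ex obtain F where F: "good F" "\<And>F'. good F' \<Longrightarrow> F \<subseteq> F' \<Longrightarrow> F' = F"
    using finite_has_maximal[of "{F. good F}"] by auto
  then obtain S where S: "finite S" "S \<subseteq> pverts G" "card S \<le> card F + 1" "\<Union>F \<subseteq> cc_hull G S"
    and FB: "F \<subseteq> block_verts" "F \<noteq> {}" by (auto simp: good_def)
  have "pverts G \<subseteq> \<Union>F"
  proof (rule ccontr)
    assume "\<not> ?thesis"
    then obtain z where z: "z \<in> pverts G" "z \<notin> \<Union>F" by auto
    obtain B0 where "B0 \<in> F" using FB by auto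
    moreover then have "B0 \<noteq> {}" "B0 \<subseteq> pverts G"
      using FB block_verts_biconnected[of B0] block_verts_subset by (auto simp: biconnected_on_def)
    ultimately obtain x where x: "x \<in> \<Union>F" "x \<in> pverts G" by blast
    \<comment> \<open>Across an edge leaving the covered part, the single new vertex
      \<open>w\<close> puts both ends into the hull and so fills a block. That block contains
      \<open>w\<close>, hence is not in \<open>F\<close>.\<close>
    obtain u w where uw: "u \<in> \<Union>F" "w \<notin> \<Union>F" "w \<in> pverts G" "(u, w) \<in> parcs G"
      using connected_on_boundary[OF conn x(2,1) z] by metis
    obtain B where B: "B \<in> block_verts" "{u, w} \<subseteq> B" using edge_block[OF uw(4)] by auto
    have S_mono: "cc_hull G S \<subseteq> cc_hull G (insert w S)"
      unfolding cc_hull_def by (rule hull_mono) auto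
    then have "u \<in> cc_hull G (insert w S)" using S uw by blast
    then have "B \<subseteq> cc_hull G (insert w S)"
      using fill[of B "insert w S" u w] B uw S cc_hull_superset[of "insert w S" G] by auto
    moreover have "B \<notin> F" using B uw by auto
    moreover have "finite F" using FB finite_block_verts finite_subset by blast
    ultimately have "good (insert B F)"
      unfolding good_def using S S_mono B FB uw
      by (intro conjI exI[of _ "insert w S"]) (auto simp: card_insert_if)
    with F(2)[of "insert B F"] \<open>B \<notin> F\<close> show False by auto
  qed
  moreover have "cc_hull G S \<subseteq> pverts G"
    using cc_convex_cc_hull[OF S(2)] by (simp add: cc_convex_def)
  ultimately have "hull_set G S" using S by (auto simp: hull_set_def)
  moreover have "card F \<le> card block_verts" using FB finite_block_verts by (simp add: card_mono)
  ultimately show thesis using S that by force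
qed

end

subsection \<open>Blocks as subgraphs\<close>

lemma biconnected_on_mono: "biconnected_on r W \<Longrightarrow> r \<subseteq> s \<Longrightarrow> biconnected_on s W"
  unfolding biconnected_on_def connected_on_def
  by (meson Int_mono order_refl rtrancl_mono subsetD)

lemma biconnected_on_Restr: "biconnected_on (Restr r W) W \<longleftrightarrow> biconnected_on r W"
proof -
  have "Restr (Restr r W) W = Restr r W" "Restr (Restr r W) (W - {v}) = Restr r (W - {v})" for v
    by auto
  then show ?thesis by (simp add: biconnected_on_def connected_on_def)
qed

section \<open>Cut-vertices and strong components of symmetric digraphs\<close>

context pseudo_graph
begin

text \<open>The bound "at most 1" also covers the empty digraph left after deleting the only vertex,
  in agreement with \<open>connected_on\<close> for the empty set.\<close>

lemma card_sccs_le_1_iff: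
  "card sccs \<le> 1 \<longleftrightarrow> (\<forall>u\<in>verts G. \<forall>v\<in>verts G. (u, v) \<in> (arcs_ends G)\<^sup>*)"
proof -
  have "scc_of u = scc_of v \<longleftrightarrow> u \<rightarrow>\<^sup>* v" if "u \<in> verts G" "v \<in> verts G" for u v
  proof
    assume "scc_of u = scc_of v"
    then have "v \<in> scc_of u" using in_scc_of_self that by blast
    then show "u \<rightarrow>\<^sup>* v" by (simp add: scc_of_def)
  next
    assume "u \<rightarrow>\<^sup>* v"
    then show "scc_of u = scc_of v" by (intro scc_of_eq scc_ofI_reachable)
  qed
  then have "scc_of u = scc_of v \<longleftrightarrow> (u, v) \<in> (arcs_ends G)\<^sup>*"
    if "u \<in> verts G" "v \<in> verts G" for u v
    using that by (simp add: reachable_conv')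
  then show ?thesis
    unfolding card_sccs_verts[symmetric] One_nat_def card_le_Suc0_iff_eq[OF finite_sccs_verts]
    by (simp add: sccs_verts_conv_scc_of)
qed

lemma connected_iff_strongly_connected: "connected G \<longleftrightarrow> strongly_connected G"
  by (simp add: connected_def strongly_connected_def reachable_mk_symmetric_eq[OF sym_arcs])

lemma Restr_arcs_ends: "Restr (arcs_ends G) (verts G) = arcs_ends G"
  by (auto dest: adj_in_verts)

lemma arcs_ends_del_vert: "arcs_ends (del_vert v) = Restr (arcs_ends G) (verts G - {v})"
  by (fastforce simp: arcs_ends_conv del_vert_simps)

lemma pseudo_graph_del_vert: "pseudo_graph (del_vert v)"
proof -
  interpret D: fin_digraph "del_vert v" by (rule fin_digraph_subgraph[OF subgraph_del_vert])
  have "symmetric (del_vert v)"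
    using sym_arcs by (auto simp: symmetric_def arcs_ends_del_vert sym_def)
  then show ?thesis by unfold_locales
qed

lemma connected_iff_connected_on:
  "connected G \<longleftrightarrow> verts G \<noteq> {} \<and> connected_on (arcs_ends G) (verts G)"
  by (auto simp: connected_iff_strongly_connected strongly_connected_def connected_on_def
      reachable_conv' Restr_arcs_ends)

text \<open>A connected digraph has exactly one component, so a vertex is a cut-vertex exactly when
  its deletion leaves more than one.\<close>

lemma connected_no_cut_vertex_iff:
  "connected G \<and> \<not> (\<exists>v. cut_vertex G v) \<longleftrightarrow> biconnected_on (arcs_ends G) (verts G)"
proof -
  have "cut_vertex G v \<longleftrightarrow> \<not> connected_on (arcs_ends G) (verts G - {v})"
    if "connected G" "v \<in> verts G" for v
  proof -
    interpret D: pseudo_graph "del_vert v" by (rule pseudo_graph_del_vert)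
    have "card sccs = 1"
      using that(1) by (simp add: connected_iff_strongly_connected strongly_connected_eq_iff)
    then have "cut_vertex G v \<longleftrightarrow> \<not> card D.sccs \<le> 1" using that(2) by (auto simp: cut_vertex_def)
    then show ?thesis
      by (simp only: D.card_sccs_le_1_iff verts_del_vert arcs_ends_del_vert connected_on_def)
  qed
  then show ?thesis
    unfolding biconnected_on_def connected_iff_connected_on
    by (auto simp: cut_vertex_def connected_iff_connected_on)
qed

end

section \<open>Maximal subgraphs and maximal vertex sets\<close>

context pair_graph
begin

lemma arcs_ends_induce: "arcs_ends (with_proj G \<restriction> W) = Restr (parcs G) W"
  by (auto simp: arcs_ends_conv)

lemma pseudo_graph_subgraph:
  assumes "subgraph H (with_proj G)" "symmetric H"
  shows "pseudo_graph H"
proof -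
  interpret H: fin_digraph H by (rule fin_digraph_subgraph[OF assms(1)])
  show ?thesis using assms(2) by unfold_locales
qed

definition block_like :: "('a, 'a \<times> 'a) pre_digraph \<Rightarrow> bool" where
  "block_like H \<longleftrightarrow> symmetric H \<and> connected H \<and> \<not> (\<exists>v. cut_vertex H v)"

text \<open>A subgraph may lack arcs of \<open>G\<close> between its vertices, but adding arcs
  preserves biconnectivity.\<close>

lemma block_like_biconnected:
  assumes "subgraph H (with_proj G)" "block_like H"
  shows "biconnected_on (parcs G) (verts H)"
proof -
  interpret H: pseudo_graph H
    using assms by (intro pseudo_graph_subgraph) (auto simp: block_like_def)
  have "biconnected_on (arcs_ends H) (verts H)"
    using assms(2) H.connected_no_cut_vertex_iff by (auto simp: block_like_def)
  moreover have "arcs_ends H \<subseteq> parcs G" using arcs_ends_mono[OF assms(1)] by simp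
  ultimately show ?thesis by (rule biconnected_on_mono)
qed

lemma induce_block_like:
  assumes "W \<subseteq> pverts G" "biconnected_on (parcs G) W"
  shows "block_like (with_proj G \<restriction> W)"
proof -
  have sub: "subgraph (with_proj G \<restriction> W) (with_proj G)"
    using assms by (intro subgraph_induce_subgraphI) simp
  have sym: "symmetric (with_proj G \<restriction> W)"
    unfolding symmetric_def arcs_ends_induce using sym_parcs by (auto simp: sym_def)
  interpret H: pseudo_graph "with_proj G \<restriction> W" by (rule pseudo_graph_subgraph[OF sub sym])
  have "biconnected_on (arcs_ends (with_proj G \<restriction> W)) (verts (with_proj G \<restriction> W))"
    using assms(2) by (simp only: arcs_ends_induce induce_subgraph_verts biconnected_on_Restr)
  then show ?thesis using sym H.connected_no_cut_vertex_iff by (simp add: block_like_def)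
qed

text \<open>A maximal subgraph contains every arc of \<open>G\<close> between its vertices, so it is
  induced, and maximality among subgraphs becomes maximality among vertex sets.\<close>

lemma blocks_eq: "blocks G = induce_subgraph (with_proj G) ` block_verts"
proof -
  have blocks: "B \<in> blocks G \<longleftrightarrow> max_subgraph block_like B" for B
    by (simp add: blocks_def block_like_def[abs_def])
  have sub: "subgraph (with_proj G \<restriction> W) (with_proj G)" if "W \<subseteq> pverts G" for W
    using that by (intro subgraph_induce_subgraphI) simp
  have subH: "subgraph H (with_proj G \<restriction> W)"
    if "subgraph H (with_proj G)" "verts H \<subseteq> W" "W \<subseteq> pverts G" for H W
  proof -
    have "subgraph H (with_proj G \<restriction> verts H)" by (rule subgraph_induce_subgraphI2[OF that(1)])
    moreover have "arcs (with_proj G \<restriction> verts H) \<subseteq> arcs (with_proj G \<restriction> W)" using that(2) by auto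
    ultimately show ?thesis using that(2) wellformed_induce_subgraph
      by (auto simp: subgraph_def compatible_def)
  qed
  show ?thesis
  proof (intro equalityI subsetI)
    fix B assume "B \<in> blocks G"
    then have max: "max_subgraph block_like B" by (simp add: blocks)
    then have B: "subgraph B (with_proj G)" "block_like B"
      by (auto simp: max_subgraph_def)
    have V: "verts B \<subseteq> pverts G" using subgraph_imp_subverts[OF B(1)] by simp
    \<comment> \<open>Used twice: for \<open>W = verts B\<close> it shows that \<open>B\<close> is
      induced, and for arbitrary \<open>W\<close> that \<open>verts B\<close> is maximal.\<close>
    have eq: "B = with_proj G \<restriction> W"
      if W: "W \<subseteq> pverts G" "biconnected_on (parcs G) W" "verts B \<subseteq> W" for W
    proof (rule ccontr)
      assume "B \<noteq> with_proj G \<restriction> W"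
      then show False
        using max subH[OF B(1) W(3,1)] sub[OF W(1)] induce_block_like[OF W(1,2)]
        unfolding max_subgraph_def by metis
    qed
    have "biconnected_on (parcs G) (verts B)" by (rule block_like_biconnected[OF B])
    moreover from eq have "W = verts B"
      if "W \<subseteq> pverts G" "biconnected_on (parcs G) W" "verts B \<subseteq> W" for W
      using that by (metis induce_subgraph_verts)
    ultimately have "verts B \<in> block_verts" using V by (auto simp: block_verts_def)
    with eq[of "verts B"] show "B \<in> induce_subgraph (with_proj G) ` block_verts"
      using V block_verts_biconnected by blast
  next
    fix B assume "B \<in> induce_subgraph (with_proj G) ` block_verts"
    then obtain W where W: "W \<in> block_verts" "B = with_proj G \<restriction> W" by auto
    have "H = B" if H: "subgraph B H" "subgraph H (with_proj G)" "block_like H" for H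
    proof -
      have "W \<subseteq> verts H" "verts H \<subseteq> pverts G"
        using subgraph_imp_subverts[OF H(1)] subgraph_imp_subverts[OF H(2)] W by auto
      then have "verts H = W"
        using block_verts_maximal[OF W(1)] block_like_biconnected[OF H(2,3)] by blast
      then have "arcs H \<subseteq> arcs B"
        using subgraph_induce_subgraphI2[OF H(2)] W by (auto simp: subgraph_def)
      then show ?thesis
        using H(1) \<open>verts H = W\<close> W(2) by (auto simp: subgraph_def compatible_def)
    qed
    moreover have "block_like B" "subgraph B (with_proj G)"
      using W induce_block_like sub block_verts_subset block_verts_biconnected by auto
    ultimately have "max_subgraph block_like B" by (auto simp: max_subgraph_def)
    then show "B \<in> blocks G" by (simp add: blocks)
  qed
qed

lemma card_blocks: "card (blocks G) = card block_verts"
  unfolding blocks_eq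
  by (rule card_image) (metis inj_onI induce_subgraph_verts)

end

theorem theorem2:
  fixes G :: "'a pair_pre_digraph" and n p :: nat
  assumes "pair_graph G"
    and "connected (with_proj G)"
    and "chordal G"
    and "card (pverts G) = n" and "n \<ge> 2"
    and "card (blocks G) = p"
  shows "hn_cc G = p + 1"
proof -
  interpret pair_graph G by fact
  have conn: "connected_on (parcs G) (pverts G)"
    using assms(2) by (simp add: connected_iff_connected_on)
  have card: "card (pverts G) \<ge> 2" using assms by simp
  have p: "card block_verts = p" using assms(6) by (simp add: card_blocks)
  obtain S where S: "hull_set G S" "card S \<le> p + 1"
    using ex_hull_set_card_le[OF conn card \<open>chordal G\<close>] p by auto
  have ge: "p + 1 \<le> card T" if "hull_set G T" for T
    using card_hull_set_ge[OF conn card that] p by simp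
  show ?thesis unfolding hn_cc_def
  proof (rule Least_equality)
    \<comment> \<open>The lower bound applies to the small hull set \<open>S\<close> itself, so its
      cardinality is exact.\<close>
    show "\<exists>S. hull_set G S \<and> card S = p + 1" using S ge by (metis le_antisym)
  qed (use ge in auto)
qed

end
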